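(* Let $(\ell,\mathcal P,\mathcal F)$ be an arbitrary decision problem, $\eta>0$ and $\epsilon\ge0$. If $(\ell,\mathcal P,\mathcal F)$ satisfies the $\eta$-central condition up to $\epsilon$, then it satisfies the $\eta$-pseudoprobability convexity condition up to $\epsilon$. In particular, the strong $\eta$-central condition implies the strong $\eta$-pseudoprobability convexity condition.
   Context: A decision problem $(\ell,\mathcal P,\mathcal F)$ consists of a set $\mathcal P$ of probability distributions on a sample space $\mathcal Z$, a set $\mathcal F$ (the model), and a loss $\ell:\mathcal F_\ell\times\mathcal Z\to[-B,\infty]$ for some $B\ge 0$, with $\mathcal F_\ell\supseteq\mathcal F$. Write $\ell_f(z)=\ell(f,z)$ and $R(P,f)=\mathbf E_{Z\sim P}[\ell_f(Z)]$. Standing assumption: for every $P\in\mathcal P$ there is $f^\circ\in\mathcal F$ with $R(P,f^\circ)<\infty$. $\Delta(\mathcal F)$ is the set of probability distributions on $\mathcal F$ (with a $\sigma$-algebra making all expressions below measurable). Conventions: $e^{-\infty}=0$, $-\log 0=\infty$. Mix loss: $m^\eta_\Pi(z)=-\frac1\eta\log\mathbf E_{f\sim\Pi}[e^{-\eta\ell_f(z)}]$. For $\eta>0,\epsilon\ge0$, $(\ell,\mathcal P,\mathcal F)$ satisfies the $\eta$-central condition up to $\epsilon$ if there is $\phi:\mathcal P\to\mathcal F$ with $\mathbf E_{Z\sim P}\mathbf E_{f\sim\Pi}[e^{\eta(\ell_{\phi(P)}(Z)-\ell_f(Z))}]\le e^{\eta\epsilon}$ for all $P\in\mathcal P$, $\Pi\in\Delta(\mathcal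 F)$ (this is understood to include $\ell_{\phi(P)}(Z)<\infty$ $P$-a.s.). Strong: holds up to $0$. It satisfies the $\eta$-pseudoprobability convexity (PPC) condition up to $\epsilon$ if there is $\phi:\mathcal P\to\mathcal F$ with $\mathbf E_{Z\sim P}[\ell_{\phi(P)}(Z)]\le\mathbf E_{Z\sim P}[m^\eta_\Pi(Z)]+\epsilon$ for all $P\in\mathcal P$, $\Pi\in\Delta(\mathcal F)$. Strong: holds up to $0$. *)

theory Defs
  imports "HOL-Probability.Probability"
begin

text \<open>
  Exponential and logarithm on the extended half-line, with
  \<open>exp (-\<infinity>) = 0\<close> and \<open>log 0 = -\<infinity>\<close>, so that \<open>- log 0 = \<infinity>\<close>.
\<close>

definition exp_ext :: "ereal \<Rightarrow> ennreal" where
  "exp_ext x = (if x = \<infinity> then top else if x = -\<infinity> then 0 else ennreal (exp (real_of_ereal x)))"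

definition log_ext :: "ennreal \<Rightarrow> ereal" where
  "log_ext x = (if x = top then \<infinity> else if x = 0 then -\<infinity> else ereal (ln (enn2real x)))"

text \<open>
  The expectation of an extended-real-valued function as the difference of the integrals of its
  positive and negative parts (\<open>e2ennreal\<close> truncates negative values to \<open>0\<close>). Below it is only
  applied to functions that are bounded below by a real constant, for which the second integral
  is finite.
\<close>

definition expect :: "'a measure \<Rightarrow> ('a \<Rightarrow> ereal) \<Rightarrow> ereal" where
  "expect M g =
     enn2ereal (\<integral>\<^sup>+ x. e2ennreal (g x) \<partial>M) - enn2ereal (\<integral>\<^sup>+ x. e2ennreal (- g x) \<partial>M)"

definition risk :: "('f \<Rightarrow> 'z \<Rightarrow> ereal) \<Rightarrow> 'z measure \<Rightarrow> 'f \<Rightarrow> ereal" where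
  "risk l P f = expect P (\<lambda>z. l f z)"

text \<open>
  The mix loss of a distribution \<open>Q\<close> on the model. The integrand is nonnegative, so the inner
  expectation is a nonnegative integral.
\<close>

definition mix_loss :: "('f \<Rightarrow> 'z \<Rightarrow> ereal) \<Rightarrow> real \<Rightarrow> 'f measure \<Rightarrow> 'z \<Rightarrow> ereal" where
  "mix_loss l \<eta> Q z = - (ereal (1 / \<eta>) * log_ext (\<integral>\<^sup>+ f. exp_ext (- (ereal \<eta> * l f z)) \<partial>Q))"

text \<open>
  A decision problem. The sample space is the measurable space \<open>Z\<close>; the model is \<open>space F\<close>, and
  \<open>F\<close> carries the \<open>\<sigma>\<close>-algebra on it, so that the distributions on the model are the elements of
  \<open>space (prob_algebra F)\<close>. (Only the \<open>\<sigma>\<close>-algebras of \<open>Z\<close> and \<open>F\<close> matter, not their measures.)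
  \<open>Fl\<close> is the possibly larger set on which the loss is defined.

  The last three assumptions say that the expressions occurring in the definitions are measurable.
  They are implied by joint measurability of the loss on \<open>F \<Otimes>\<^sub>M Z\<close>.
\<close>

locale decision_problem =
  fixes Z :: "'z measure"
    and F :: "'f measure"
    and Fl :: "'f set"
    and B :: real
    and l :: "'f \<Rightarrow> 'z \<Rightarrow> ereal"
    and \<P> :: "'z measure set"
  assumes distributions: "\<P> \<subseteq> space (prob_algebra Z)"
    and model_subset: "space F \<subseteq> Fl"
    and bound_nonneg: "0 \<le> B"
    and loss_bounded_below: "\<And>f z. f \<in> Fl \<Longrightarrow> z \<in> space Z \<Longrightarrow> ereal (- B) \<le> l f z"
    and finite_risk: "\<And>P. P \<in> \<P> \<Longrightarrow> \<exists>f\<in>space F. risk l P f < \<infinity>"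
    and measurable_sample: "\<And>f. f \<in> space F \<Longrightarrow> (\<lambda>z. l f z) \<in> borel_measurable Z"
    and measurable_model: "\<And>z. z \<in> space Z \<Longrightarrow> (\<lambda>f. l f z) \<in> borel_measurable F"
    and measurable_mix_loss:
      "\<And>\<eta> Q. 0 < \<eta> \<Longrightarrow> Q \<in> space (prob_algebra F) \<Longrightarrow> mix_loss l \<eta> Q \<in> borel_measurable Z"

text \<open>
  Almost sure finiteness of the comparator's loss is part of the central condition; it also
  ensures that no \<open>\<infinity> - \<infinity>\<close> occurs in the exponent outside a null set.
\<close>

definition central_condition ::
    "'f measure \<Rightarrow> ('f \<Rightarrow> 'z \<Rightarrow> ereal) \<Rightarrow> 'z measure set \<Rightarrow> real \<Rightarrow> real \<Rightarrow> bool" where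
  "central_condition F l \<P> \<eta> \<epsilon> \<longleftrightarrow>
     (\<exists>\<phi> \<in> \<P> \<rightarrow> space F. \<forall>P\<in>\<P>.
        (AE z in P. l (\<phi> P) z < \<infinity>) \<and>
        (\<forall>Q\<in>space (prob_algebra F).
           (\<integral>\<^sup>+ z. (\<integral>\<^sup>+ f. exp_ext (ereal \<eta> * (l (\<phi> P) z - l f z)) \<partial>Q) \<partial>P)
             \<le> ennreal (exp (\<eta> * \<epsilon>))))"

definition strong_central_condition ::
    "'f measure \<Rightarrow> ('f \<Rightarrow> 'z \<Rightarrow> ereal) \<Rightarrow> 'z measure set \<Rightarrow> real \<Rightarrow> bool" where
  "strong_central_condition F l \<P> \<eta> \<longleftrightarrow> central_condition F l \<P> \<eta> 0"

definition ppc_condition ::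
    "'f measure \<Rightarrow> ('f \<Rightarrow> 'z \<Rightarrow> ereal) \<Rightarrow> 'z measure set \<Rightarrow> real \<Rightarrow> real \<Rightarrow> bool" where
  "ppc_condition F l \<P> \<eta> \<epsilon> \<longleftrightarrow>
     (\<exists>\<phi> \<in> \<P> \<rightarrow> space F. \<forall>P\<in>\<P>. \<forall>Q\<in>space (prob_algebra F).
        expect P (\<lambda>z. l (\<phi> P) z) \<le> expect P (\<lambda>z. mix_loss l \<eta> Q z) + ereal \<epsilon>)"

definition strong_ppc_condition ::
    "'f measure \<Rightarrow> ('f \<Rightarrow> 'z \<Rightarrow> ereal) \<Rightarrow> 'z measure set \<Rightarrow> real \<Rightarrow> bool" where
  "strong_ppc_condition F l \<P> \<eta> \<longleftrightarrow> ppc_condition F l \<P> \<eta> 0"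

end

theory Submission
  imports Defs
begin

text \<open>
  Keep the same \<open>\<phi>\<close>. Where \<open>a = l (\<phi> P) z\<close> is finite, the inner expectation in the central
  condition is \<open>exp (\<eta> * (a - m))\<close> with \<open>m\<close> the mix loss at \<open>z\<close>, and \<open>1 + x \<le> exp x\<close> at
  \<open>x = \<eta> * (a - m - \<epsilon>)\<close> gives \<open>a + 1 / \<eta> \<le> m + \<epsilon> + exp (- \<eta> * \<epsilon>) / \<eta> * exp (\<eta> * (a - m))\<close>.
  Integrating, the last term contributes at most \<open>1 / \<eta>\<close>. Unlike Jensen's inequality, this needs
  no integrability: after a shift by \<open>B\<close> all integrands are nonnegative.
\<close>

lemma borel_measurable_exp_ext [measurable]: "exp_ext \<in> borel_measurable borel"
  unfolding exp_ext_def by measurable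

text \<open>One summand is real, so its exponential is neither \<open>0\<close> nor
  \<open>top\<close>, and neither the sum nor the product meets an indeterminate form.\<close>

lemma exp_ext_add: "exp_ext (ereal r + x) = ennreal (exp r) * exp_ext x"
  by (cases x) (auto simp: exp_ext_def exp_add ennreal_mult ennreal_mult_top)

lemma exp_ext_mono: "x \<le> y \<Longrightarrow> exp_ext x \<le> exp_ext y"
  by (cases x; cases y) (auto simp: exp_ext_def intro!: ennreal_leI)

lemma exp_ext_le_exp_iff: "exp_ext x \<le> exp_ext y \<longleftrightarrow> x \<le> y"
proof
  assume "exp_ext x \<le> exp_ext y"
  then show "x \<le> y"
    by (cases x; cases y) (auto simp: exp_ext_def ennreal_le_iff top_unique)
qed (rule exp_ext_mono)

text \<open>Gives the mix loss a logarithm-free form. The conventions for \<open>log_ext\<close> at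
  \<open>0\<close> and \<open>top\<close> make it exact when the mix loss is infinite, so no case
  split is needed later.\<close>

lemma exp_ext_mix_loss:
  assumes "0 < \<eta>"
  shows "exp_ext (- (ereal \<eta> * mix_loss l \<eta> Q z))
    = (\<integral>\<^sup>+ f. exp_ext (- (ereal \<eta> * l f z)) \<partial>Q)"
proof -
  define I where "I = (\<integral>\<^sup>+ f. exp_ext (- (ereal \<eta> * l f z)) \<partial>Q)"
  have "exp_ext (- (ereal \<eta> * - (ereal (1 / \<eta>) * log_ext I))) = I"
  proof (cases I rule: ennreal_cases)
    case (real r)
    then show ?thesis
      using assms by (cases "r = 0") (auto simp: log_ext_def exp_ext_def)
  qed (use assms in \<open>simp add: log_ext_def exp_ext_def\<close>)
  then show ?thesis
    by (simp add: mix_loss_def I_def)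
qed

text \<open>Averaging against a probability measure preserves the upper bound on the exponentials.
  With c = -B, the mix loss becomes eligible for the same shift by B as the loss itself.\<close>

lemma mix_loss_ge:
  assumes "0 < \<eta>" and "prob_space Q"
    and "\<And>f. f \<in> space Q \<Longrightarrow> ereal c \<le> l f z"
  shows "ereal c \<le> mix_loss l \<eta> Q z"
proof -
  interpret prob_space Q by fact
  have "(\<integral>\<^sup>+ f. exp_ext (- (ereal \<eta> * l f z)) \<partial>Q) \<le> (\<integral>\<^sup>+ f. exp_ext (- (ereal \<eta> * ereal c)) \<partial>Q)"
    using assms(1,3)
    by (intro nn_integral_mono exp_ext_mono) (simp only: ereal_minus_le_minus ereal_mult_left_mono ereal_less_eq less_imp_le)
  then have "- (ereal \<eta> * mix_loss l \<eta> Q z) \<le> - (ereal \<eta> * ereal c)"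
    using assms(1) by (simp add: exp_ext_mix_loss [symmetric] emeasure_space_1 exp_ext_le_exp_iff)
  then show ?thesis
    using assms(1) by (cases "mix_loss l \<eta> Q z") auto
qed

text \<open>For finite a the factor exp(\<eta> a) leaves the integral, also where the loss of f is
  infinite. What remains is the exponential form of the mix loss.\<close>

lemma nn_integral_exp_ext_diff:
  assumes "0 < \<eta>" and [measurable]: "(\<lambda>f. l f z) \<in> borel_measurable Q"
  shows "(\<integral>\<^sup>+ f. exp_ext (ereal \<eta> * (ereal a - l f z)) \<partial>Q)
    = exp_ext (ereal \<eta> * (ereal a - mix_loss l \<eta> Q z))"
proof -
  have split: "exp_ext (ereal \<eta> * (ereal a - x))
    = ennreal (exp (\<eta> * a)) * exp_ext (- (ereal \<eta> * x))" for x
  proof -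
    have "ereal \<eta> * (ereal a - x) = ereal (\<eta> * a) + - (ereal \<eta> * x)"
      using assms(1) by (cases x) (auto simp: algebra_simps)
    then show ?thesis
      by (simp only: exp_ext_add)
  qed
  show ?thesis
    unfolding split exp_ext_mix_loss [OF assms(1)] by (rule nn_integral_cmult) measurable
qed

text \<open>Reduces comparing expectations to comparing nonnegative integrals. Splitting g into
  positive and negative parts gives (g + B) + g^- = g^+ + B pointwise, an identity without
  subtraction that can be integrated term by term.\<close>

lemma expect_bounded_below:
  assumes "prob_space M" and [measurable]: "g \<in> borel_measurable M" and "0 \<le> B"
    and lower: "\<And>x. x \<in> space M \<Longrightarrow> ereal (- B) \<le> g x"
  shows "expect M g = enn2ereal (\<integral>\<^sup>+ x. e2ennreal (g x + ereal B) \<partial>M) - ereal B"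
proof -
  interpret prob_space M by fact
  let ?pos = "\<integral>\<^sup>+ x. e2ennreal (g x) \<partial>M" and ?neg = "\<integral>\<^sup>+ x. e2ennreal (- g x) \<partial>M"
    and ?shift = "\<integral>\<^sup>+ x. e2ennreal (g x + ereal B) \<partial>M"
  have pointwise: "e2ennreal (g x + ereal B) + e2ennreal (- g x) = e2ennreal (g x) + ennreal B"
    and neg_le: "e2ennreal (- g x) \<le> ennreal B" if "x \<in> space M" for x
  proof -
    from lower [OF that] \<open>0 \<le> B\<close>
    show "e2ennreal (g x + ereal B) + e2ennreal (- g x) = e2ennreal (g x) + ennreal B"
      by (cases "g x"; cases "0 \<le> g x")
        (auto simp: ennreal_neg e2ennreal_ereal simp flip: ennreal_plus)
    from lower [OF that] show "e2ennreal (- g x) \<le> ennreal B"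
      by (cases "g x") (auto simp: e2ennreal_ereal e2ennreal_neg intro!: ennreal_leI)
  qed
  have "?shift + ?neg = (\<integral>\<^sup>+ x. e2ennreal (g x + ereal B) + e2ennreal (- g x) \<partial>M)"
    by (rule nn_integral_add [symmetric]) measurable
  also have "\<dots> = (\<integral>\<^sup>+ x. e2ennreal (g x) + ennreal B \<partial>M)"
    by (intro nn_integral_cong pointwise)
  also have "\<dots> = ?pos + ennreal B"
    by (subst nn_integral_add) (auto simp: emeasure_space_1)
  finally have eq: "enn2ereal ?shift + enn2ereal ?neg = enn2ereal ?pos + ereal B"
    using \<open>0 \<le> B\<close> by (metis plus_ennreal.rep_eq enn2ereal_ennreal)
  have "?neg \<le> (\<integral>\<^sup>+ x. ennreal B \<partial>M)"
    by (intro nn_integral_mono neg_le)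
  \<comment> \<open>Only a finite negative part can be moved across \<open>eq\<close>; the other two
    integrals may be infinite.\<close>
  then have "?neg < \<infinity>"
    by (auto simp: emeasure_space_1 intro: le_less_trans)
  then obtain r where "enn2ereal ?neg = ereal r"
    by (cases ?neg rule: ennreal_cases) auto
  with eq show ?thesis
    unfolding expect_def by (cases "enn2ereal ?shift"; cases "enn2ereal ?pos") auto
qed

text \<open>Keeping 1 / \<eta> on the left makes every term nonnegative, so the inequality can be
  stated in \<open>ennreal\<close> without truncated subtraction.\<close>

lemma loss_le_mix_loss_exp_ext:
  assumes "0 < \<eta>" "0 \<le> \<epsilon>" "- B \<le> a" "ereal (- B) \<le> m"
  shows "e2ennreal (ereal a + ereal B) + ennreal (1 / \<eta>)
    \<le> e2ennreal (m + ereal B) + ennreal \<epsilon>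
      + ennreal (exp (- \<eta> * \<epsilon>) / \<eta>) * exp_ext (ereal \<eta> * (ereal a - m))"
proof (cases m)
  case (real r)
  have "1 + \<eta> * (a - r - \<epsilon>) \<le> exp (\<eta> * (a - r - \<epsilon>))"
    by (rule exp_ge_add_one_self)
  also have "\<dots> = exp (- \<eta> * \<epsilon>) * exp (\<eta> * (a - r))"
    by (simp add: algebra_simps flip: exp_add)
  finally have "(1 + \<eta> * (a - r - \<epsilon>)) / \<eta> \<le> exp (- \<eta> * \<epsilon>) * exp (\<eta> * (a - r)) / \<eta>"
    using assms(1) by (simp add: divide_right_mono)
  then have "(a + B) + 1 / \<eta> \<le> (r + B) + \<epsilon> + exp (- \<eta> * \<epsilon>) / \<eta> * exp (\<eta> * (a - r))"
    using assms(1) by (simp add: add_divide_distrib)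
  with assms real show ?thesis
    by (simp add: e2ennreal_ereal exp_ext_def ennreal_leI flip: ennreal_plus ennreal_mult)
\<comment> \<open>For m = \<infinity> the right-hand side is \<open>top\<close>; m = -\<infinity>
  contradicts the lower bound.\<close>
qed (use assms in auto)

lemma central_condition_imp_ppc_condition:
  assumes "decision_problem Z F Fl B l \<P>" and "0 < \<eta>" "0 \<le> \<epsilon>"
    and "central_condition F l \<P> \<eta> \<epsilon>"
  shows "ppc_condition F l \<P> \<eta> \<epsilon>"
proof -
  interpret decision_problem Z F Fl B l \<P> by fact
  from assms(4) obtain \<phi> where \<phi>: "\<phi> \<in> \<P> \<rightarrow> space F"
    and fin: "\<And>P. P \<in> \<P> \<Longrightarrow> AE z in P. l (\<phi> P) z < \<infinity>"
    and central: "\<And>P Q. P \<in> \<P> \<Longrightarrow> Q \<in> space (prob_algebra F) \<Longrightarrow>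
      (\<integral>\<^sup>+ z. (\<integral>\<^sup>+ f. exp_ext (ereal \<eta> * (l (\<phi> P) z - l f z)) \<partial>Q) \<partial>P) \<le> ennreal (exp (\<eta> * \<epsilon>))"
    unfolding central_condition_def by blast
  have "expect P (\<lambda>z. l (\<phi> P) z) \<le> expect P (\<lambda>z. mix_loss l \<eta> Q z) + ereal \<epsilon>"
    if P: "P \<in> \<P>" and Q: "Q \<in> space (prob_algebra F)" for P Q
  proof -
    have "prob_space P" and sets_P: "sets P = sets Z"
      using P distributions by (auto simp: space_prob_algebra)
    have "prob_space Q" and sets_Q: "sets Q = sets F"
      using Q by (auto simp: space_prob_algebra)
    interpret P: prob_space P by fact
    note space_P = sets_eq_imp_space_eq [OF sets_P] and space_Q = sets_eq_imp_space_eq [OF sets_Q]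
    have \<phi>P: "\<phi> P \<in> space F"
      using \<phi> P by blast
    let ?a = "l (\<phi> P)" and ?m = "mix_loss l \<eta> Q"
    \<comment> \<open>The constant \<open>?c\<close> is chosen so that \<open>?c\<close> times the
      bound exp(\<eta> \<epsilon>) of the central condition is exactly 1 / \<eta>.\<close>
    let ?J = "\<lambda>z. exp_ext (ereal \<eta> * (?a z - ?m z))" and ?c = "exp (- \<eta> * \<epsilon>) / \<eta>"
    have [measurable]: "?a \<in> borel_measurable P" "?m \<in> borel_measurable P"
      using measurable_sample [OF \<phi>P] measurable_mix_loss [OF assms(2) Q]
      by (simp_all add: measurable_cong_sets [OF sets_P refl])
    have a_ge: "ereal (- B) \<le> ?a z" if "z \<in> space P" for z
      using that \<phi>P model_subset by (auto simp: space_P intro!: loss_bounded_below)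
    have m_ge: "ereal (- B) \<le> ?m z" if "z \<in> space P" for z
      using that model_subset
      by (intro mix_loss_ge assms(2) \<open>prob_space Q\<close> loss_bounded_below) (auto simp: space_P space_Q)
    have real_a: "AE z in P. z \<in> space P \<and> (\<exists>a \<ge> - B. ?a z = ereal a)"
      using fin [OF P] AE_space
    proof eventually_elim
      case (elim z)
      with a_ge [of z] show ?case by (cases "?a z") auto
    qed
    \<comment> \<open>\<open>?J\<close> is measurable in z because \<open>?m\<close> is, so its
      integral can be split off below. Almost sure equality suffices to carry over the central
      bound.\<close>
    then have J_eq: "AE z in P. ?J z = (\<integral>\<^sup>+ f. exp_ext (ereal \<eta> * (?a z - l f z)) \<partial>Q)"
    proof eventually_elim
      case (elim z)
      then have "(\<lambda>f. l f z) \<in> borel_measurable Q"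
        using measurable_model [of z] by (simp add: measurable_cong_sets [OF sets_Q refl] space_P)
      with elim assms(2) show ?case
        by (auto simp: nn_integral_exp_ext_diff)
    qed
    from real_a have bound: "AE z in P. e2ennreal (?a z + ereal B) + ennreal (1 / \<eta>)
        \<le> e2ennreal (?m z + ereal B) + ennreal \<epsilon> + ennreal ?c * ?J z"
    proof eventually_elim
      case (elim z)
      then obtain a where "- B \<le> a" "?a z = ereal a" "z \<in> space P"
        by blast
      with loss_le_mix_loss_exp_ext [OF assms(2,3) _ m_ge, of a z] show ?case
        by simp
    qed
    have J_le: "ennreal ?c * (\<integral>\<^sup>+ z. ?J z \<partial>P) \<le> ennreal (1 / \<eta>)"
    proof -
      have "ennreal ?c * (\<integral>\<^sup>+ z. ?J z \<partial>P) \<le> ennreal ?c * ennreal (exp (\<eta> * \<epsilon>))"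
        using central [OF P Q] nn_integral_cong_AE [OF J_eq] by (intro mult_left_mono) auto
      also have "\<dots> = ennreal (1 / \<eta>)"
        using assms(2) by (simp flip: ennreal_mult exp_add)
      finally show ?thesis .
    qed
    let ?A = "\<integral>\<^sup>+ z. e2ennreal (?a z + ereal B) \<partial>P" and ?M = "\<integral>\<^sup>+ z. e2ennreal (?m z + ereal B) \<partial>P"
    have "?A + ennreal (1 / \<eta>) = (\<integral>\<^sup>+ z. e2ennreal (?a z + ereal B) + ennreal (1 / \<eta>) \<partial>P)"
      by (subst nn_integral_add) (auto simp: P.emeasure_space_1)
    also have "\<dots> \<le> (\<integral>\<^sup>+ z. e2ennreal (?m z + ereal B) + ennreal \<epsilon> + ennreal ?c * ?J z \<partial>P)"
      by (rule nn_integral_mono_AE [OF bound])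
    also have "\<dots> = ?M + ennreal \<epsilon> + ennreal ?c * (\<integral>\<^sup>+ z. ?J z \<partial>P)"
      by (simp add: nn_integral_add nn_integral_cmult P.emeasure_space_1)
    also have "\<dots> \<le> ?M + ennreal \<epsilon> + ennreal (1 / \<eta>)"
      by (intro add_left_mono J_le)
    \<comment> \<open>The cancelled term 1 / \<eta> is finite, so this is sound even if
      \<open>?A\<close> or \<open>?M\<close> is infinite.\<close>
    finally have "?A \<le> ?M + ennreal \<epsilon>"
      by (simp add: add.commute [of _ "ennreal (1 / \<eta>)"] ennreal_add_left_cancel_le)
    then have "enn2ereal ?A \<le> enn2ereal ?M + ereal \<epsilon>"
      using assms(3) by (simp add: less_eq_ennreal.rep_eq plus_ennreal.rep_eq)
    then have "enn2ereal ?A - ereal B \<le> enn2ereal ?M - ereal B + ereal \<epsilon>"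
      by (cases "enn2ereal ?A"; cases "enn2ereal ?M") auto
    then show ?thesis
      by (simp add: expect_bounded_below [OF \<open>prob_space P\<close> _ bound_nonneg] a_ge m_ge)
  qed
  with \<phi> show ?thesis
    unfolding ppc_condition_def by blast
qed

theorem proposition3p9:
  fixes Z :: "'z measure" and F :: "'f measure" and Fl :: "'f set"
    and B :: real and l :: "'f \<Rightarrow> 'z \<Rightarrow> ereal" and \<P> :: "'z measure set"
    and \<eta> \<epsilon> :: real
  assumes "decision_problem Z F Fl B l \<P>"
    and "0 < \<eta>" and "0 \<le> \<epsilon>"
  shows "(central_condition F l \<P> \<eta> \<epsilon> \<longrightarrow> ppc_condition F l \<P> \<eta> \<epsilon>) \<and>
         (strong_central_condition F l \<P> \<eta> \<longrightarrow> strong_ppc_condition F l \<P> \<eta>)"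
  \<comment> \<open>\<epsilon> stays schematic here, so that the same fact also serves the strong
    case \<epsilon> = 0.\<close>
  using central_condition_imp_ppc_condition [OF assms(1,2)] assms(3)
  unfolding strong_central_condition_def strong_ppc_condition_def by auto

end
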